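(* Let $G$ be a connected bipartite graph with bipartition $(X,Y)$, and let $n\geq 6$ be an even integer. Then $G\times C_n$ has exactly two connected components, which are isomorphic. If $|X|\geq\delta(G)+1$, $|Y|\geq\delta(G)+1$ and $\kappa(G)>\frac{4}{n}\delta(G)$, then both connected components of $G\times C_{n}$ are super-$\kappa$.
   Context: All graphs are simple. $C_n$ is the cycle on $n$ vertices. The direct product $G\times H$ has vertex set $V(G)\times V(H)$, with $(u_1,v_1)(u_2,v_2)$ an edge iff $u_1u_2\in E(G)$ and $v_1v_2\in E(H)$. $\delta(G)$ is the minimum degree. For a non-complete graph $G$, the connectivity $\kappa(G)$ is the minimum size of a vertex set $S$ such that $G-S$ is disconnected; for a complete graph $\kappa(G)=|V(G)|-1$. A graph is super connected (super-$\kappa$) if every minimum vertex cut is the neighborhood of some vertex of minimum degree. *)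

theory Defs
  imports Complex_Main "Graph_Theory.Graph_Theory"
begin

text \<open>
  As in the theory Digraph, a finite simple graph is a finite symmetric loop-free digraph without
  parallel arcs (\<^locale>\<open>pair_graph\<close>, and \<^locale>\<open>graph\<close> for general arc types): an edge is a pair
  of opposite arcs. In particular the degree of a vertex is its \<^const>\<open>out_degree\<close>.
\<close>

definition cycle_graph :: "nat \<Rightarrow> nat pair_pre_digraph" where
  "cycle_graph n = \<lparr> pverts = {..<n},
     parcs = {(i, j). i < n \<and> j < n \<and> (j = (i + 1) mod n \<or> i = (j + 1) mod n)} \<rparr>"

definition direct_product ::
    "'a pair_pre_digraph \<Rightarrow> 'b pair_pre_digraph \<Rightarrow> ('a \<times> 'b) pair_pre_digraph" where
  "direct_product G H = \<lparr> pverts = pverts G \<times> pverts H,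
     parcs = {((u1, v1), (u2, v2)). (u1, u2) \<in> parcs G \<and> (v1, v2) \<in> parcs H} \<rparr>"

text \<open>
  Both parts are required to be nonempty. For a connected graph this only excludes the graph with
  a single vertex, whose product with a cycle has no edges at all.
\<close>

definition bipartition :: "('a, 'b) pre_digraph \<Rightarrow> 'a set \<Rightarrow> 'a set \<Rightarrow> bool" where
  "bipartition G X Y \<longleftrightarrow> X \<noteq> {} \<and> Y \<noteq> {} \<and> X \<inter> Y = {} \<and> X \<union> Y = verts G \<and>
     arcs_ends G \<subseteq> X \<times> Y \<union> Y \<times> X"

definition connected_components :: "('a, 'b) pre_digraph \<Rightarrow> ('a, 'b) pre_digraph set" where
  "connected_components G = {H. pre_digraph.max_subgraph G connected H}"

definition neighborhood :: "('a, 'b) pre_digraph \<Rightarrow> 'a \<Rightarrow> 'a set" where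
  "neighborhood G v = {u. v \<rightarrow>\<^bsub>G\<^esub> u}"

definition min_degree :: "('a, 'b) pre_digraph \<Rightarrow> nat" where
  "min_degree G = Min (out_degree G ` verts G)"

text \<open>
  The library's \<^const>\<open>connected\<close> is false for the graph without vertices. Deleting all vertices
  does not count as disconnecting a graph, so this case is excluded explicitly; a complete graph
  then has no vertex cut.
\<close>

definition vertex_cut :: "('a, 'b) pre_digraph \<Rightarrow> 'a set \<Rightarrow> bool" where
  "vertex_cut G S \<longleftrightarrow>
     S \<subseteq> verts G \<and> verts G - S \<noteq> {} \<and> \<not> connected (G \<restriction> (verts G - S))"

definition vertex_connectivity :: "('a, 'b) pre_digraph \<Rightarrow> nat" where
  "vertex_connectivity G =
     (if complete_digraph (card (verts G)) G then card (verts G) - 1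
      else Min (card ` {S. vertex_cut G S}))"

definition min_vertex_cut :: "('a, 'b) pre_digraph \<Rightarrow> 'a set \<Rightarrow> bool" where
  "min_vertex_cut G S \<longleftrightarrow> vertex_cut G S \<and> card S = vertex_connectivity G"

definition super_connected :: "('a, 'b) pre_digraph \<Rightarrow> bool" where
  "super_connected G \<longleftrightarrow>
     (\<forall>S. min_vertex_cut G S \<longrightarrow>
        (\<exists>v \<in> verts G. out_degree G v = min_degree G \<and> S = neighborhood G v))"

lemma pair_graph_cycle_graph:
  assumes "n \<ge> 3"
  shows "pair_graph (cycle_graph n)"
proof
  show "finite (parcs (cycle_graph n))"
    by (rule finite_subset[of _ "{..<n} \<times> {..<n}"]) (auto simp: cycle_graph_def)
  show "symmetric (with_proj (cycle_graph n))"
    by (auto simp: symmetric_def sym_def cycle_graph_def)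
  show "fst e \<noteq> snd e" if "e \<in> parcs (cycle_graph n)" for e
    using that assms by (auto simp: cycle_graph_def mod_Suc split: if_splits)
qed (auto simp: cycle_graph_def)

lemma pair_graph_direct_product:
  assumes "pair_graph G" and "pair_graph H"
  shows "pair_graph (direct_product G H)"
proof -
  interpret G: pair_graph G by fact
  interpret H: pair_graph H by fact
  show ?thesis
  proof
    show fin: "finite (pverts (direct_product G H))"
      by (simp add: direct_product_def G.pair_finite_verts H.pair_finite_verts)
    show "finite (parcs (direct_product G H))"
      by (rule finite_subset[of _ "pverts (direct_product G H) \<times> pverts (direct_product G H)"])
        (use fin in \<open>auto simp: direct_product_def dest: G.wellformed' H.wellformed'\<close>)
    show "symmetric (with_proj (direct_product G H))"
      by (auto simp: symmetric_def sym_def direct_product_def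
          intro: G.arcs_symmetric H.arcs_symmetric)
  qed (auto simp: direct_product_def dest: G.wellformed' H.wellformed' G.no_loops')
qed

end

theory Submission
  imports Defs
begin

text \<open>
  Each component of the product is a cyclic arrangement of $n$ layers, alternately copies of $X$ and
  of $Y$, in which any two consecutive layers span a copy of $G$. Let $S$ be a minimum cut; the
  neighborhood of a vertex of minimum degree shows $|S| \le 2\delta$. The $n$ copies of $G$ meet $S$
  in at most $4\delta < n\kappa(G)$ vertices altogether, so some copy minus $S$ is still connected,
  and one side $B$ of the cut misses its two layers. Cut the cycle open there, and let $p \le q$ be
  the first and last layers meeting $B$. Layers $p-1$ and $q+1$ of $S$ contain the neighbors of
  $B_p$ and $B_q$, hence at least $\delta$ vertices each; so they have exactly $\delta$ vertices and
  exhaust $S$. If $p < q$, then $S$ misses layers $p$ and $p+1$, which by connectedness of $G$ lie in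
  $B$, and $S$ contains all of layer $p-1$, which is too large. So $p = q$, and both layers of $S$
  are copies of the neighborhood of a vertex in $B_p$.
\<close>

subsection \<open>Connectedness, components and degrees\<close>

text \<open>These sets are the unions of connected components. Describing the sides of a cut by them
  replaces walks by one condition on arcs.\<close>

definition closed_under_arcs :: "('a, 'b) pre_digraph \<Rightarrow> 'a set \<Rightarrow> bool" where
  "closed_under_arcs G B \<longleftrightarrow> B \<subseteq> verts G \<and> (\<forall>(u, v) \<in> arcs_ends G. u \<in> B \<longleftrightarrow> v \<in> B)"

lemma closed_under_arcsI:
  assumes "B \<subseteq> verts G" and "\<And>u v. u \<rightarrow>\<^bsub>G\<^esub> v \<Longrightarrow> u \<in> B \<longleftrightarrow> v \<in> B"
  shows "closed_under_arcs G B"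
  using assms by (auto simp: closed_under_arcs_def)

lemma closed_under_arcsD:
  assumes "closed_under_arcs G B" and "u \<rightarrow>\<^bsub>G\<^esub> v"
  shows "u \<in> B \<longleftrightarrow> v \<in> B"
  using assms by (auto simp: closed_under_arcs_def)

lemma (in wf_digraph) closed_under_arcs_Diff:
  "closed_under_arcs G B \<Longrightarrow> closed_under_arcs G (verts G - B)"
  by (auto simp: closed_under_arcs_def arcs_ends_conv)

text \<open>\<open>connected\<close> means reachability in the symmetric closure. Walks there never
  leave a closed set; conversely, the set of vertices reachable from \<open>u\<close> is closed, so
  it is everything when only trivial sets are closed.\<close>

lemma (in wf_digraph) connected_iff_closed:
  "connected G \<longleftrightarrow>
     verts G \<noteq> {} \<and> (\<forall>B. closed_under_arcs G B \<longrightarrow> B = {} \<or> B = verts G)"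
proof -
  interpret S: pair_wf_digraph "mk_symmetric G" by (rule wellformed_mk_symmetric)
  have ends: "parcs (mk_symmetric G) = arcs_ends G \<union> (arcs_ends G)\<inverse>"
    by (auto simp: parcs_mk_symmetric arcs_ends_conv)
  have closed: "closed_under_arcs (mk_symmetric G) B \<longleftrightarrow> closed_under_arcs G B" for B
    by (auto simp: closed_under_arcs_def ends)
  show ?thesis
  proof (intro iffI conjI allI impI)
    assume conn: "connected G"
    then show "verts G \<noteq> {}"
      by (auto simp: connected_def strongly_connected_def)
    fix B assume B: "closed_under_arcs G B"
    have reach: "u \<in> B \<longrightarrow> v \<in> B" if "u \<rightarrow>\<^sup>*\<^bsub>mk_symmetric G\<^esub> v" for u v
      using that
    proof (induction rule: S.reachable_induct)
      case base
      then show ?case by simp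
    next
      case (step v w)
      then show ?case
        using closed_under_arcsD[of "mk_symmetric G" B v w] B closed by auto
    qed
    show "B = {} \<or> B = verts G"
      using conn reach B
      by (auto simp: connected_def strongly_connected_def closed_under_arcs_def)
  next
    assume *: "verts G \<noteq> {} \<and> (\<forall>B. closed_under_arcs G B \<longrightarrow> B = {} \<or> B = verts G)"
    show "connected G"
      unfolding connected_def
    proof (rule strongly_connectedI)
      show "verts (mk_symmetric G) \<noteq> {}" using * by simp
      fix u v assume uv: "u \<in> verts (mk_symmetric G)" "v \<in> verts (mk_symmetric G)"
      let ?B = "{w. u \<rightarrow>\<^sup>*\<^bsub>mk_symmetric G\<^esub> w}"
      have "x \<in> ?B" if "w \<in> ?B" "(w, x) \<in> parcs (mk_symmetric G)" for w x
        using that S.reachable_adj_trans by auto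
      then have "closed_under_arcs (mk_symmetric G) ?B"
        using S.reachable_in_verts by (auto simp: closed_under_arcs_def ends)
      then have "?B = verts G"
        using * closed S.reachable_refl uv by (metis (mono_tags, lifting) empty_iff mem_Collect_eq with_proj_simps(1))
      then show "u \<rightarrow>\<^sup>*\<^bsub>mk_symmetric G\<^esub> v"
        using uv by auto
    qed
  qed
qed

lemma dominates_induce_iff:
  "u \<rightarrow>\<^bsub>G \<restriction> S\<^esub> v \<longleftrightarrow> u \<in> S \<and> v \<in> S \<and> u \<rightarrow>\<^bsub>G\<^esub> v"
  by (auto simp: arcs_ends_conv)

text \<open>Since no arc joins \<open>V\<close> to \<open>W\<close>, a connected subgraph stays on
  one side and is contained in the subgraph induced there.\<close>

lemma (in wf_digraph) connected_components_of_partition: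
  assumes verts: "verts G = V \<union> W" and disj: "V \<inter> W = {}"
    and ends: "arcs_ends G \<subseteq> V \<times> V \<union> W \<times> W"
    and connV: "connected (G \<restriction> V)" and connW: "connected (G \<restriction> W)"
  shows "connected_components G = {G \<restriction> V, G \<restriction> W}"
proof -
  have closed: "closed_under_arcs H (verts H \<inter> U)" if "subgraph H G" "U = V \<or> U = W" for H U
  proof -
    have "arcs_ends H \<subseteq> arcs_ends G"
      using that by (auto simp: subgraph_def compatible_def arcs_ends_conv)
    moreover have "arcs_ends H \<subseteq> verts H \<times> verts H"
      using that by (auto simp: subgraph_def arcs_ends_conv wf_digraph_def)
    moreover have "x \<in> U \<longleftrightarrow> y \<in> U" if "(x, y) \<in> arcs_ends G" for x y
      using \<open>U = V \<or> U = W\<close> ends disj that by blast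
    ultimately show ?thesis
      unfolding closed_under_arcs_def by blast
  qed
  have one_side: "verts H \<subseteq> U" if "subgraph H G" "connected H" "U = V \<or> U = W" "verts H \<inter> U \<noteq> {}" for H U
    using closed[of H U] that wf_digraph.connected_iff_closed[of H]
    by (auto simp: subgraph_def)
  have in_induced: "subgraph H (G \<restriction> U)" if "subgraph H G" "verts H \<subseteq> U" for H U
    using that wf_digraph.wellformed[of H] by (auto simp: subgraph_def compatible_def)
  have sub: "subgraph (G \<restriction> V) G" "subgraph (G \<restriction> W) G"
    using verts by (auto intro: subgraph_induce_subgraphI)
  have maximal: "max_subgraph connected (G \<restriction> U)" if U: "U = V \<or> U = W" for U
  proof (rule max_subgraphI)
    show "connected (G \<restriction> U)" using U connV connW by auto
    show "subgraph (G \<restriction> U) G" using U sub by auto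
    fix H' assume H': "G \<restriction> U \<noteq> H'" "subgraph (G \<restriction> U) H'" "subgraph H' G"
    show "\<not> connected H'"
    proof
      assume "connected H'"
      have "U \<subseteq> verts H'" using H'(2) by (auto simp: subgraph_def)
      moreover have "U \<noteq> {}" using U connV connW
        by (auto simp: connected_def strongly_connected_def)
      ultimately have "verts H' \<subseteq> U"
        using one_side[OF H'(3) \<open>connected H'\<close> U] by blast
      then have "subgraph H' (G \<restriction> U)"
        by (rule in_induced[OF H'(3)])
      then have "G \<restriction> U = H'"
        using H'(2) by (auto simp: subgraph_def compatible_def intro!: pre_digraph.equality)
      then show False using H'(1) by simp
    qed
  qed
  show ?thesis
  proof (intro equalityI subsetI)
    fix H assume "H \<in> connected_components G"
    then have H: "max_subgraph connected H" "subgraph H G" "connected H"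
      by (auto simp: connected_components_def max_subgraph_def)
    then have "verts H \<noteq> {}" by (auto simp: connected_def strongly_connected_def)
    moreover have "verts H \<subseteq> V \<union> W" using H(2) verts by (auto simp: subgraph_def)
    ultimately have "verts H \<inter> V \<noteq> {} \<or> verts H \<inter> W \<noteq> {}" by auto
    then obtain U where U: "U = V \<or> U = W" "verts H \<inter> U \<noteq> {}" by auto
    then have "subgraph H (G \<restriction> U)"
      using one_side[OF H(2,3)] in_induced[OF H(2)] by simp
    then have "H = G \<restriction> U"
      using max_subgraph_subg_eq H(1) maximal[OF U(1)] by simp
    then show "H \<in> {G \<restriction> V, G \<restriction> W}" using U by auto
  qed (use maximal in \<open>auto simp: connected_components_def\<close>)
qed

text \<open>Arcs are pairs of vertices, so \<open>f\<close> dictates the map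
  \<open>map_prod f f\<close> on arcs; preserving adjacency in both directions makes it
  onto.\<close>

lemma digraph_iso_induced:
  assumes "wf_digraph (with_proj G)" and bij: "bij_betw f V W"
    and arcs: "\<And>u v. u \<in> V \<Longrightarrow> v \<in> V \<Longrightarrow> (u, v) \<in> parcs G \<longleftrightarrow> (f u, f v) \<in> parcs G"
  shows "digraph_iso (with_proj G \<restriction> V) (with_proj G \<restriction> W)"
proof -
  let ?hom = "\<lparr>iso_verts = f, iso_arcs = map_prod f f, iso_head = snd, iso_tail = fst\<rparr>"
  have inj: "inj_on f V" and img: "f ` V = W"
    using bij by (auto simp: bij_betw_def)
  have "pre_digraph.digraph_isomorphism (with_proj G \<restriction> V) ?hom"
    using inj wf_digraph.wellformed_induce_subgraph[OF assms(1)]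
    by (auto simp: pre_digraph.digraph_isomorphism_def inj_on_def)
  moreover have "map_prod f f ` {e \<in> parcs G. fst e \<in> V \<and> snd e \<in> V}
      = {e \<in> parcs G. fst e \<in> W \<and> snd e \<in> W}"
    using arcs img by (auto simp: image_iff) (metis imageE)
  then have "with_proj G \<restriction> W = app_iso ?hom (with_proj G \<restriction> V)"
    using img by (auto simp: app_iso_def intro!: pre_digraph.equality)
  ultimately show ?thesis unfolding digraph_iso_def by blast
qed

section \<open>Degrees, neighborhoods and vertex cuts\<close>

lemma (in nomulti_digraph) out_degree_eq_card_neighborhood:
  "out_degree G v = card (neighborhood G v)"
proof -
  have "inj_on (head G) (out_arcs G v)"
    by (auto simp: inj_on_def out_arcs_def arc_to_ends_def intro!: no_multi_arcs)
  moreover have "neighborhood G v = head G ` out_arcs G v"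
    by (auto simp: neighborhood_def out_arcs_def arcs_ends_conv image_iff)
  ultimately show ?thesis
    by (simp add: out_degree_def card_image)
qed

lemma (in fin_digraph) vertex_connectivity_le:
  assumes "\<not> complete_digraph (card (verts G)) G" and "vertex_cut G S"
  shows "vertex_connectivity G \<le> card S"
proof -
  have "{S. vertex_cut G S} \<subseteq> Pow (verts G)" by (auto simp: vertex_cut_def)
  then have "finite {S. vertex_cut G S}" by (rule finite_subset) simp
  then show ?thesis
    using assms by (auto simp: vertex_connectivity_def intro!: Min_le)
qed

text \<open>Once its neighborhood is deleted, \<open>v\<close> is isolated, so \<open>{v}\<close> is
  closed, and the surviving \<open>w\<close> shows that it is not everything.\<close>

lemma (in graph) vertex_cut_neighborhood:
  assumes "v \<in> verts G" and "w \<in> verts G" and "v \<noteq> w" and "w \<notin> neighborhood G v"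
  shows "vertex_cut G (neighborhood G v)"
proof -
  let ?K = "G \<restriction> (verts G - neighborhood G v)"
  have v: "v \<notin> neighborhood G v" using no_loops by (auto simp: neighborhood_def arcs_ends_conv)
  have "closed_under_arcs ?K {v}"
    using assms(1) v graph_symmetric
    by (auto simp: closed_under_arcs_def dominates_induce_iff neighborhood_def)
  moreover have "{v} \<noteq> verts ?K" using assms by (auto simp: neighborhood_def)
  ultimately have "\<not> connected ?K"
    using wf_digraph.connected_iff_closed[OF wellformed_induce_subgraph] by blast
  then show ?thesis
    using assms(1) v by (auto simp: vertex_cut_def neighborhood_def arcs_ends_conv)
qed

text \<open>Serves to select the branch of \<open>vertex_connectivity\<close> that minimizes over
  vertex cuts.\<close>

lemma not_complete_digraph:
  assumes "graph H" and "v \<in> verts H" "w \<in> verts H" "v \<noteq> w" "w \<notin> neighborhood H v"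
  shows "\<not> complete_digraph m H"
  using assms by (auto simp: complete_digraph_def neighborhood_def)

subsection \<open>Layers of the product\<close>

text \<open>Moving the window up by one replaces \<open>f h\<close> by the equal value
  \<open>f (h + n)\<close>.\<close>

lemma sum_period:
  fixes f :: "nat \<Rightarrow> 'a :: comm_monoid_add"
  assumes "\<And>k. f (k + n) = f k"
  shows "sum f {h..<h + n} = sum f {..<n}"
proof (induction h)
  case 0
  then show ?case by (simp add: lessThan_atLeast0)
next
  case (Suc h)
  show ?case
  proof (cases "n = 0")
    case False
    have "sum f {Suc h..<Suc h + n} = sum f {Suc h..<h + n} + f (h + n)"
      using False by simp
    also have "\<dots> = f h + sum f {Suc h..<h + n}"
      by (simp add: assms add.commute)
    also have "\<dots> = sum f {h..<h + n}"
      using False by (simp add: sum.atLeast_Suc_lessThan)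
    finally show ?thesis using Suc by simp
  qed simp
qed

text \<open>The representative of \<open>i\<close> is taken from the block of length
  \<open>n\<close> containing \<open>h\<close> if \<open>h mod n \<le> i\<close>, and from the next
  block otherwise.\<close>

lemma exists_mod_in_window:
  fixes i n h :: nat
  assumes "i < n"
  shows "\<exists>k \<in> {h..<h + n}. k mod n = i"
proof (cases "h mod n \<le> i")
  case True
  have "h = n * (h div n) + h mod n" by simp
  then have "h \<le> n * (h div n) + i" "n * (h div n) + i < h + n"
    using True assms by linarith+
  then have "n * (h div n) + i \<in> {h..<h + n}" by simp
  moreover have "(n * (h div n) + i) mod n = i" using assms by simp
  ultimately show ?thesis by blast
next
  case False
  have "h = n * (h div n) + h mod n" "h mod n < n" using assms by simp_all
  then have "h \<le> n * (h div n) + n + i" "n * (h div n) + n + i < h + n"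
    using False by linarith+
  then have "n * Suc (h div n) + i \<in> {h..<h + n}" by simp
  moreover have "(n * Suc (h div n) + i) mod n = i"
    using assms by (metis add.commute mod_less mod_mult_self2)
  ultimately show ?thesis by blast
qed

text \<open>The assumptions are symmetric in \<open>X\<close> and \<open>Y\<close>, so interpreting
  the locale with the parts interchanged transfers every result to the other component.\<close>

locale bipartite_cycle_product = pair_graph G
  for G :: "'a pair_pre_digraph" +
  fixes X Y :: "'a set" and n :: nat
  assumes connected_G: "connected (with_proj G)"
    and bipartition_G: "bipartition (with_proj G) X Y"
    and n_ge_3: "n \<ge> 3"
    and even_n: "even n"
begin

definition layer :: "nat \<Rightarrow> 'a set" where
  "layer k = (if even k then X else Y)"

text \<open>
  The component containing \<^term>\<open>X \<times> {0}\<close>; the other one is obtained by interchanging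
  \<^term>\<open>X\<close> and \<^term>\<open>Y\<close>.
\<close>

definition half :: "('a \<times> nat) set" where
  "half = {(u, i). i < n \<and> u \<in> layer i}"

abbreviation component :: "('a \<times> nat, ('a \<times> nat) \<times> 'a \<times> nat) pre_digraph" where
  "component \<equiv> with_proj (direct_product G (cycle_graph n)) \<restriction> half"

text \<open>
  Slices are indexed by all natural numbers, periodically: a window of $n$ consecutive indices cuts
  the cycle open at an arbitrary place.
\<close>

definition slice :: "('a \<times> nat) set \<Rightarrow> nat \<Rightarrow> 'a set" where
  "slice B k = {u. (u, k mod n) \<in> B}"

abbreviation nbrs :: "'a \<Rightarrow> 'a set" where
  "nbrs v \<equiv> neighborhood (with_proj G) v"

lemma nbrs_iff: "v \<in> nbrs u \<longleftrightarrow> (u, v) \<in> parcs G"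
  by (simp add: neighborhood_def)

lemma layer_disjoint: "layer k \<inter> layer (Suc k) = {}"
  using bipartition_G by (auto simp: layer_def bipartition_def)

lemma layer_Un: "layer k \<union> layer (Suc k) = pverts G"
  using bipartition_G by (auto simp: layer_def bipartition_def)

lemma layer_nonempty: "layer k \<noteq> {}"
  using bipartition_G by (auto simp: layer_def bipartition_def)

lemma layer_arc: "(u, v) \<in> parcs G \<Longrightarrow> u \<in> layer k \<longleftrightarrow> v \<in> layer (Suc k)"
  using bipartition_G by (auto simp: layer_def bipartition_def)

lemma layer_Suc_Suc: "layer (Suc (Suc k)) = layer k"
  by (simp add: layer_def)

text \<open>As \<open>n\<close> is even, reduction modulo \<open>n\<close> keeps parity, so the
  alternation of \<open>X\<close> and \<open>Y\<close> closes up around the cycle.\<close>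

lemma layer_mod: "layer (k mod n) = layer k"
  using even_n by (simp add: layer_def dvd_mod_iff)

lemma finite_layer: "finite (layer k)"
  using layer_Un[of k] pair_finite_verts by (metis finite_Un)

lemma n_pos: "0 < n"
  using n_ge_3 by simp

lemma mem_half_mod: "(u, k mod n) \<in> half \<longleftrightarrow> u \<in> layer k"
  using n_pos by (simp add: half_def layer_mod)

lemma slice_subset_layer: "B \<subseteq> half \<Longrightarrow> slice B k \<subseteq> layer k"
  using mem_half_mod by (auto simp: slice_def)

lemma slice_period: "slice B (k + n) = slice B k"
  by (simp add: slice_def)

lemma finite_slice: "B \<subseteq> half \<Longrightarrow> finite (slice B k)"
  using slice_subset_layer finite_layer finite_subset by metis

section \<open>The component as a graph: arcs and neighborhoods\<close>

lemma half_subset: "half \<subseteq> verts (with_proj (direct_product G (cycle_graph n)))"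
  using layer_Un by (auto simp: half_def direct_product_def cycle_graph_def)

lemma graph_product: "pair_graph (direct_product G (cycle_graph n))"
  using n_ge_3 by (intro pair_graph_direct_product pair_graph_cycle_graph) unfold_locales

lemma graph_component: "graph component"
proof -
  interpret P: pair_graph "direct_product G (cycle_graph n)" by (rule graph_product)
  have ind: "induced_subgraph component (with_proj (direct_product G (cycle_graph n)))"
    using half_subset by (intro P.induced_induce) simp
  interpret D: digraph component using ind by (rule P.digraphI_induced)
  interpret S: sym_digraph component using ind by (rule P.induced_graph_imp_graph)
  show ?thesis by unfold_locales
qed

text \<open>That the head lies in \<open>half\<close> is automatic: an arc of \<open>G\<close>
  changes the part while a step in the cycle changes the parity of the index.\<close>

lemma component_arc_iff:
  "(u, k mod n) \<rightarrow>\<^bsub>component\<^esub> (v, j) \<longleftrightarrow>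
     u \<in> layer k \<and> (u, v) \<in> parcs G \<and> j < n \<and> (j = Suc k mod n \<or> k mod n = Suc j mod n)"
proof -
  have "v \<in> layer j"
    if "u \<in> layer k" "(u, v) \<in> parcs G" "j = Suc k mod n \<or> k mod n = Suc j mod n"
    using that(3)
  proof
    assume "j = Suc k mod n"
    then show ?thesis using that layer_arc layer_mod by blast
  next
    assume "k mod n = Suc j mod n"
    then have "layer k = layer (Suc j)" by (metis layer_mod)
    then show ?thesis using that layer_arc[of u v "Suc j"] by (simp add: layer_Suc_Suc)
  qed
  then show ?thesis
    using n_pos
    by (auto simp: dominates_induce_iff direct_product_def cycle_graph_def half_def layer_mod mod_simps)
qed

lemma mod_Suc_cancel: "Suc i mod n = Suc j mod n \<longleftrightarrow> i mod n = j mod n"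
  using n_pos by (auto simp: mod_Suc split: if_splits)

text \<open>Centering at \<open>Suc r\<close> names both adjacent layers without
  subtraction.\<close>

lemma neighborhood_component:
  assumes "v \<in> layer (Suc r)"
  shows "neighborhood component (v, Suc r mod n) = nbrs v \<times> {r mod n, Suc (Suc r) mod n}"
proof (rule set_eqI)
  fix w :: "'a \<times> nat"
  obtain u j where w: "w = (u, j)" by fastforce
  have "j < n \<and> (j = Suc (Suc r) mod n \<or> Suc r mod n = Suc j mod n)
      \<longleftrightarrow> j = r mod n \<or> j = Suc (Suc r) mod n"
    using n_pos mod_Suc_cancel[of r j] by (auto simp: mod_simps)
  then show "w \<in> neighborhood component (v, Suc r mod n)
      \<longleftrightarrow> w \<in> nbrs v \<times> {r mod n, Suc (Suc r) mod n}"
    using assms w by (auto simp: neighborhood_def component_arc_iff)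
qed

text \<open>A cycle with at least three vertices has distinct layers before and after a given one;
  this is why degrees double in the component.\<close>

lemma mod_n_neq: "r mod n \<noteq> Suc (Suc r) mod n"
  using n_ge_3 by (auto simp: mod_Suc split: if_splits)

lemma card_neighborhood_component:
  assumes "(v, i) \<in> half"
  shows "card (neighborhood component (v, i)) = 2 * card (nbrs v)"
proof -
  \<comment> \<open>Adding \<open>n\<close> first gives the index a predecessor even when
    \<open>i = 0\<close>.\<close>
  have "i = Suc (i + n - 1) mod n" using assms n_pos by (simp add: half_def)
  moreover have "v \<in> layer (Suc (i + n - 1))"
    using assms even_n n_pos by (simp add: half_def layer_def)
  ultimately show ?thesis
    using neighborhood_component[of v "i + n - 1"] mod_n_neq[of "i + n - 1"]
    by (simp add: card_cartesian_product)
qed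

text \<open>An isolated vertex would be a closed set, hence all of \<open>G\<close>, leaving no room
  for two disjoint nonempty parts.\<close>

lemma nbrs_nonempty:
  assumes "v \<in> pverts G"
  shows "nbrs v \<noteq> {}"
proof
  assume empty: "nbrs v = {}"
  then have "closed_under_arcs (with_proj G) {v}"
    using assms arcs_symmetric by (auto simp: closed_under_arcs_def neighborhood_def)
  then have "pverts G = {v}"
    using connected_G connected_iff_closed by auto
  then have "layer 0 = {v}" "layer (Suc 0) = {v}"
    using layer_Un[of 0] layer_nonempty[of 0] layer_nonempty[of "Suc 0"] by auto
  then show False
    using layer_disjoint[of 0] by simp
qed

lemma component_arc_up:
  assumes "(u, v) \<in> parcs G" and "u \<in> layer k"
  shows "(u, k mod n) \<rightarrow>\<^bsub>component\<^esub> (v, Suc k mod n)"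
  using assms n_pos by (simp add: component_arc_iff)

section \<open>Closed sets slice by slice, and connectedness of the component\<close>

lemma closed_slice_iff:
  assumes "closed_under_arcs component B" and "(u, v) \<in> parcs G" and "u \<in> layer k"
  shows "u \<in> slice B k \<longleftrightarrow> v \<in> slice B (Suc k)"
  using closed_under_arcsD[OF assms(1) component_arc_up[OF assms(2,3)]] by (simp add: slice_def)

lemma closed_slice_Diff_iff:
  assumes "closed_under_arcs (component \<restriction> (half - S)) B"
    and "(u, v) \<in> parcs G" and "u \<in> layer k" and "u \<notin> slice S k" and "v \<notin> slice S (Suc k)"
  shows "u \<in> slice B k \<longleftrightarrow> v \<in> slice B (Suc k)"
proof -
  have "v \<in> layer (Suc k)" using assms layer_arc by blast
  then have "(u, k mod n) \<rightarrow>\<^bsub>component \<restriction> (half - S)\<^esub> (v, Suc k mod n)"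
    unfolding dominates_induce_iff[of _ _ component]
    using assms component_arc_up mem_half_mod by (simp add: slice_def)
  then show ?thesis
    using closed_under_arcsD[OF assms(1)] by (simp add: slice_def)
qed

text \<open>Layers \<open>k\<close> and \<open>Suc k\<close> span a copy of \<open>G\<close>, in
  which the two slices of \<open>B\<close> together form a closed set; connectedness of
  \<open>G\<close> makes it the whole copy.\<close>

lemma closed_slice_all:
  assumes B: "closed_under_arcs component B" and "slice B k \<noteq> {}"
  shows "slice B (Suc k) = layer (Suc k)"
proof -
  have sub: "slice B k \<subseteq> layer k" "slice B (Suc k) \<subseteq> layer (Suc k)"
    using B by (auto intro!: slice_subset_layer simp: closed_under_arcs_def)
  let ?D = "slice B k \<union> slice B (Suc k)"
  have "x \<in> ?D \<longleftrightarrow> y \<in> ?D" if "(x, y) \<in> parcs G" for x y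
  proof (cases "x \<in> layer k")
    case True
    then have "y \<in> layer (Suc k)" using that layer_arc by blast
    then show ?thesis
      using True that closed_slice_iff[OF B] sub layer_disjoint by blast
  next
    case False
    then have "x \<in> layer (Suc k)" using that layer_Un[of k] in_arcsD1 by blast
    moreover have "y \<in> layer k"
      using layer_arc[of y x] arcs_symmetric that calculation by blast
    ultimately show ?thesis
      using that arcs_symmetric closed_slice_iff[OF B, of y x k] sub layer_disjoint by blast
  qed
  then have "closed_under_arcs (with_proj G) ?D"
    using sub layer_Un[of k] by (auto simp: closed_under_arcs_def)
  then have "?D = pverts G"
    using assms(2) connected_G connected_iff_closed by auto
  then show ?thesis
    using sub layer_Un[of k] layer_disjoint[of k] by blast
qed

lemma connected_component: "connected component"
proof -
  interpret C: graph component by (rule graph_component)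
  have "B = half" if B: "closed_under_arcs component B" "B \<noteq> {}" for B
  proof
    show "B \<subseteq> half" using B by (simp add: closed_under_arcs_def)
    obtain u i where ui: "(u, i) \<in> B" using B by auto
    then have i: "i < n" using \<open>B \<subseteq> half\<close> by (auto simp: half_def)
    \<comment> \<open>One nonempty slice fills the next layer, and fullness then spreads upwards
      around the cycle.\<close>
    have all: "slice B (Suc (i + j)) = layer (Suc (i + j))" for j
    proof (induction j)
      case 0
      have "slice B i \<noteq> {}" using ui i by (auto simp: slice_def)
      then show ?case using closed_slice_all[OF B(1)] by simp
    next
      case (Suc j)
      then have "slice B (Suc (i + j)) \<noteq> {}" using layer_nonempty by simp
      then show ?case using closed_slice_all[OF B(1)] by simp
    qed
    show "half \<subseteq> B"
    proof (rule subrelI)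
      fix v j assume "(v, j) \<in> half"
      then have "j < n" "v \<in> layer j" by (auto simp: half_def)
      \<comment> \<open>Since \<open>i < n\<close>, the index \<open>j + n\<close> lies above
        \<open>i\<close> and is reached; periodicity leads back to \<open>j\<close>.\<close>
      moreover have "slice B (j + n) = layer (j + n)"
        using all[of "j + n - Suc i"] i by simp
      moreover have "layer (j + n) = layer j" by (metis layer_mod mod_add_self2)
      ultimately show "(v, j) \<in> B" by (auto simp: slice_def)
    qed
  qed
  moreover have "half \<noteq> {}"
    using layer_nonempty[of 0] n_pos by (auto simp: half_def)
  ultimately show ?thesis
    using C.connected_iff_closed by auto
qed

section \<open>The minimum degree of the component\<close>

lemma min_degree_le: "v \<in> pverts G \<Longrightarrow> min_degree (with_proj G) \<le> card (nbrs v)"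
  using pair_finite_verts by (auto simp: min_degree_def out_degree_eq_card_neighborhood intro!: Min_le)

lemma min_degree_attained: "\<exists>v \<in> pverts G. card (nbrs v) = min_degree (with_proj G)"
proof -
  have "pverts G \<noteq> {}" using layer_Un layer_nonempty by blast
  then have "min_degree (with_proj G) \<in> out_degree (with_proj G) ` pverts G"
    using pair_finite_verts by (auto simp: min_degree_def intro!: Min_in)
  then show ?thesis by (auto simp: out_degree_eq_card_neighborhood)
qed

lemma finite_nbrs: "finite (nbrs v)"
  by (rule finite_subset[OF _ pair_finite_verts]) (auto simp: nbrs_iff dest: in_arcsD2)

lemma out_degree_component:
  assumes "(v, i) \<in> half"
  shows "out_degree component (v, i) = 2 * card (nbrs v)"
proof -
  interpret C: graph component by (rule graph_component)
  show ?thesis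
    using assms by (simp add: C.out_degree_eq_card_neighborhood card_neighborhood_component)
qed

lemma half_over: "v \<in> pverts G \<Longrightarrow> \<exists>i. (v, i) \<in> half"
  using layer_Un[of 0] mem_half_mod[of v 0] mem_half_mod[of v "Suc 0"] by blast

text \<open>Degrees double on passing to a copy of a vertex, and every vertex of \<open>G\<close>
  has a copy in \<open>half\<close>.\<close>

lemma min_degree_component: "min_degree component = 2 * min_degree (with_proj G)"
proof -
  have fin: "finite half"
    by (rule finite_subset[of _ "pverts G \<times> {..<n}"])
      (use layer_Un pair_finite_verts in \<open>auto simp: half_def\<close>)
  obtain v where v: "v \<in> pverts G" "card (nbrs v) = min_degree (with_proj G)"
    using min_degree_attained by blast
  then obtain i where i: "(v, i) \<in> half" using half_over by blast
  have "2 * min_degree (with_proj G) \<le> d" if d: "d \<in> out_degree component ` half" for d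
  proof -
    obtain w where w: "w \<in> half" "d = out_degree component w"
      using d by blast
    obtain u j where uj: "w = (u, j)" by fastforce
    have "d = 2 * card (nbrs u)" "(u, j) \<in> half"
      using w uj out_degree_component by simp_all
    then show ?thesis using min_degree_le layer_Un[of j] by (auto simp: half_def)
  qed
  moreover have "2 * min_degree (with_proj G) \<in> out_degree component ` half"
    by (rule image_eqI[OF _ i]) (simp add: out_degree_component[OF i] v)
  ultimately show ?thesis
    unfolding min_degree_def[of component] using fin by (intro Min_eqI) auto
qed

subsection \<open>Minimum cuts\<close>

text \<open>The counting argument, isolated on an interval of indices without wrap-around so that
  \<open>B\<close> has a first and a last layer. In the use below, \<open>B\<close> and
  \<open>S\<close> are the slices of one side and of the cut.\<close>

lemma separating_slices:
  fixes B S :: "nat \<Rightarrow> 'a set" and h m :: nat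
  assumes B: "\<And>k. B k \<subseteq> layer k" and S: "\<And>k. S k \<subseteq> layer k"
    and up: "\<And>k u v. (u, v) \<in> parcs G \<Longrightarrow> u \<in> B k \<Longrightarrow> v \<in> B (Suc k) \<union> S (Suc k)"
    and down: "\<And>k u v. (u, v) \<in> parcs G \<Longrightarrow> v \<in> B (Suc k) \<Longrightarrow> u \<in> B k \<union> S k"
    and ends: "B h = {}" "B m = {}"
    and inner: "h \<le> k0" "k0 \<le> m" "B k0 \<noteq> {}"
    and small: "(\<Sum>k = h..m. card (S k)) \<le> 2 * min_degree (with_proj G)"
    and large: "\<And>k. min_degree (with_proj G) < card (layer k)"
  obtains r v where "h \<le> r" "Suc (Suc r) \<le> m" "v \<in> layer (Suc r)"
    "S r = nbrs v" "S (Suc (Suc r)) = nbrs v" "card (nbrs v) = min_degree (with_proj G)"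
    "\<And>k. h \<le> k \<Longrightarrow> k \<le> m \<Longrightarrow> k \<noteq> r \<Longrightarrow> k \<noteq> Suc (Suc r) \<Longrightarrow> S k = {}"
proof -
  let ?\<delta> = "min_degree (with_proj G)"
  define K where "K = {k. h \<le> k \<and> k \<le> m \<and> B k \<noteq> {}}"
  define p q where "p = Min K" and "q = Max K"
  have "finite K" by (auto simp: K_def)
  moreover have "K \<noteq> {}" using inner by (auto simp: K_def)
  ultimately have K: "p \<in> K" "q \<in> K" "\<And>k. k \<in> K \<Longrightarrow> p \<le> k \<and> k \<le> q"
    by (auto simp: p_def q_def)
  then have pq: "h \<le> p" "q \<le> m" "B p \<noteq> {}" "B q \<noteq> {}" and "p \<le> q"
    using K(3)[OF K(2)] by (auto simp: K_def)
  have outside: "B k = {}" if "h \<le> k" "k \<le> m" "k < p \<or> q < k" for k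
  proof -
    have "k \<notin> K" using K(3)[of k] that by linarith
    then show ?thesis using that by (simp add: K_def)
  qed
  \<comment> \<open>The empty slices at both ends leave room in the interval for the layers
    \<open>p - 1\<close> and \<open>q + 1\<close>.\<close>
  have "p \<noteq> h" "q \<noteq> m" using pq ends by auto
  then obtain r where r: "p = Suc r" "h \<le> r" "Suc q \<le> m"
    using pq \<open>p \<le> q\<close> by (cases p) auto
  have fin: "finite (S k)" for k using S finite_layer finite_subset by metis
  have first: "nbrs u \<subseteq> S r" if "u \<in> B p" for u
  proof
    fix v assume "v \<in> nbrs u"
    then have "(v, u) \<in> parcs G" using arcs_symmetric by (simp add: nbrs_iff)
    moreover have "B r = {}" using outside[of r] r pq \<open>p \<le> q\<close> by simp
    ultimately show "v \<in> S r" using down[of v u r] that r by auto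
  qed
  have last: "nbrs u \<subseteq> S (Suc q)" if "u \<in> B q" for u
    using up[of u _ q] outside[of "Suc q"] that r \<open>p \<le> q\<close> by (auto simp: nbrs_iff)
  have deg: "?\<delta> \<le> card (nbrs u)" if "u \<in> B k" for u k
    using that B layer_Un[of k] by (intro min_degree_le) auto
  obtain x y where xy: "x \<in> B p" "y \<in> B q" using pq by auto
  have low: "?\<delta> \<le> card (S r)" "?\<delta> \<le> card (S (Suc q))"
    using card_mono[OF fin first[OF xy(1)]] card_mono[OF fin last[OF xy(2)]]
      deg[OF xy(1)] deg[OF xy(2)] by auto
  \<comment> \<open>As \<open>r < p \<le> q\<close>, the two layers are distinct and contribute
    \<delta> each, which already uses up the bound \<open>small\<close>.\<close>
  let ?R = "{h..m} - {r, Suc q}"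
  have "{h..m} = insert r (insert (Suc q) ?R)"
    using r \<open>p \<le> q\<close> by auto
  then have "(\<Sum>k = h..m. card (S k)) = card (S r) + (card (S (Suc q)) + (\<Sum>k \<in> ?R. card (S k)))"
    using r \<open>p \<le> q\<close> by (subst \<open>{h..m} = _\<close>, subst sum.insert) auto
  then have eq: "card (S r) = ?\<delta>" "card (S (Suc q)) = ?\<delta>" "(\<Sum>k \<in> ?R. card (S k)) = 0"
    using small low by linarith+
  then have empty: "S k = {}" if "h \<le> k" "k \<le> m" "k \<noteq> r" "k \<noteq> Suc q" for k
    using that fin by auto
  have "p = q"
  proof (rule ccontr)
    assume "p \<noteq> q"
    \<comment> \<open>Here \<open>r < p < Suc p < Suc q\<close>, so neither index is one of the two
      layers carrying \<open>S\<close>.\<close>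
    then have Sp: "S p = {}" "S (Suc p) = {}"
      using r pq empty \<open>p \<le> q\<close> by auto
    let ?D = "B p \<union> B (Suc p)"
    have step: "x \<in> ?D \<Longrightarrow> y \<in> ?D" if "(x, y) \<in> parcs G" for x y
      using up[of x y p] down[of y x p] arcs_symmetric that Sp by blast
    then have "x \<in> ?D \<longleftrightarrow> y \<in> ?D" if "(x, y) \<in> parcs G" for x y
      using that arcs_symmetric by blast
    moreover have "?D \<subseteq> pverts G"
      using B[of p] B[of "Suc p"] layer_Un[of p] by blast
    ultimately have "closed_under_arcs (with_proj G) ?D"
      by (auto simp: closed_under_arcs_def)
    then have "?D = pverts G"
      using pq connected_G connected_iff_closed by auto
    then have full: "B p = layer p"
      using B[of p] B[of "Suc p"] layer_Un[of p] layer_disjoint[of p] by blast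
    \<comment> \<open>Each vertex of layer \<open>r\<close> has a neighbor in layer
      \<open>p\<close>, all of which is in \<open>B\<close>; by \<open>first\<close> it belongs to
      \<open>S\<close>. This contradicts \<open>large\<close>.\<close>
    have "layer r \<subseteq> S r"
    proof
      fix u assume u: "u \<in> layer r"
      then have "nbrs u \<noteq> {}" using nbrs_nonempty[of u] layer_Un[of r] by blast
      then obtain v where v: "(u, v) \<in> parcs G" by (auto simp: nbrs_iff)
      then have "v \<in> B p" using u layer_arc[of u v r] full r by simp
      then show "u \<in> S r" using first[of v] arcs_symmetric[OF v] by (auto simp: nbrs_iff)
    qed
    then show False
      using card_mono[OF fin, of "layer r" r] large[of r] eq by simp
  qed
  \<comment> \<open>With \<open>p = q\<close>, the vertex \<open>x\<close> is in both extreme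
    layers; its at least \<delta> neighbors fill each of two sets of size \<delta>.\<close>
  have nb: "nbrs x = S r" "nbrs x = S (Suc q)"
    using card_seteq[OF fin first[OF xy(1)]] card_seteq[OF fin last[of x]] xy(1) \<open>p = q\<close>
      deg[OF xy(1)] eq by simp_all
  show thesis
  proof (rule that)
    show "h \<le> r" "Suc (Suc r) \<le> m" "S r = nbrs x" "S (Suc (Suc r)) = nbrs x"
      using r nb \<open>p = q\<close> by auto
    show "x \<in> layer (Suc r)" using xy B r by auto
    show "card (nbrs x) = ?\<delta>" using nb eq by simp
    show "\<And>k. h \<le> k \<Longrightarrow> k \<le> m \<Longrightarrow> k \<noteq> r \<Longrightarrow> k \<noteq> Suc (Suc r) \<Longrightarrow> S k = {}"
      using empty r \<open>p = q\<close> by simp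
  qed
qed

text \<open>Over one period, tagging each slice with its index splits \<open>S\<close> into disjoint
  pieces.\<close>

lemma sum_card_slice:
  assumes "S \<subseteq> half"
  shows "(\<Sum>k = h..<h + n. card (slice S k)) = card S"
proof -
  have "(\<Sum>k = h..<h + n. card (slice S k)) = (\<Sum>k<n. card (slice S k))"
    by (rule sum_period) (simp add: slice_period)
  also have "\<dots> = (\<Sum>k<n. card (slice S k \<times> {k}))"
    by (simp add: card_cartesian_product)
  also have "\<dots> = card (\<Union>k<n. slice S k \<times> {k})"
    using finite_slice[OF assms] by (subst card_UN_disjoint) auto
  also have "(\<Union>k<n. slice S k \<times> {k}) = S"
    using assms by (auto simp: slice_def half_def)
  finally show ?thesis .
qed

text \<open>Averaging: each vertex of \<open>S\<close> lies in exactly two of the \<open>n\<close>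
  pairs of consecutive layers.\<close>

lemma exists_sparse_gap:
  assumes "S \<subseteq> half" and "2 * card S < n * c"
  shows "\<exists>k. card (slice S k) + card (slice S (Suc k)) < c"
proof (rule ccontr)
  assume "\<not> ?thesis"
  then have "(\<Sum>k<n. c) \<le> (\<Sum>k<n. card (slice S k) + card (slice S (Suc k)))"
    by (intro sum_mono) (simp add: not_less)
  also have "\<dots> = (\<Sum>k = 0..<0 + n. card (slice S k)) + (\<Sum>k = Suc 0..<Suc 0 + n. card (slice S k))"
    by (simp add: sum.distrib lessThan_atLeast0 sum.shift_bounds_Suc_ivl del: sum.op_ivl_Suc)
  also have "\<dots> = 2 * card S"
    unfolding sum_card_slice[OF assms(1)] by simp
  finally show False using assms(2) by simp
qed

text \<open>The two empty slices allow the cycle to be cut open there, which reduces the claim to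
  \<open>separating_slices\<close>.\<close>

lemma min_cut_is_neighborhood:
  assumes SB: "S \<subseteq> half" "B \<subseteq> half - S" and "B \<noteq> {}"
    and closed: "closed_under_arcs (component \<restriction> (half - S)) B"
    and gap: "slice B g = {}" "slice B (Suc g) = {}"
    and small: "card S \<le> 2 * min_degree (with_proj G)"
    and large: "\<And>k. min_degree (with_proj G) < card (layer k)"
  shows "\<exists>v \<in> verts component. out_degree component v = min_degree component \<and> S = neighborhood component v"
proof -
  \<comment> \<open>This window contains each layer once; its last index represents layer
    \<open>g\<close>, so \<open>B\<close> is empty at both ends.\<close>
  let ?h = "Suc g" and ?m = "g + n"
  have B_sub: "slice B k \<subseteq> layer k" and S_sub: "slice S k \<subseteq> layer k" for k
    using SB by (auto intro!: slice_subset_layer)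
  note arc = closed_slice_Diff_iff[OF closed]
  have disj: "slice B k \<inter> slice S k = {}" for k
    using SB by (auto simp: slice_def)
  have up: "v \<in> slice B (Suc k) \<union> slice S (Suc k)" if "(u, v) \<in> parcs G" "u \<in> slice B k" for u v k
    using arc[OF that(1), of k] that(2) B_sub[of k] disj[of k] by blast
  have down: "u \<in> slice B k \<union> slice S k" if "(u, v) \<in> parcs G" "v \<in> slice B (Suc k)" for u v k
    using arc[OF that(1), of k] that(2) B_sub[of "Suc k"] disj[of "Suc k"] layer_arc[OF that(1), of k]
    by blast
  have window: "{?h..?m} = {?h..<?h + n}" by auto
  have index: "\<exists>k. ?h \<le> k \<and> k \<le> ?m \<and> k mod n = i" if "i < n" for i
    using exists_mod_in_window[OF that, of ?h] unfolding window[symmetric] by auto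
  obtain w i where "(w, i) \<in> B" using \<open>B \<noteq> {}\<close> by auto
  then have "i < n" using SB by (auto simp: half_def)
  then obtain k0 where k0: "?h \<le> k0" "k0 \<le> ?m" "k0 mod n = i" using index by blast
  then have inner: "slice B k0 \<noteq> {}" using \<open>(w, i) \<in> B\<close> by (auto simp: slice_def)
  have sum: "(\<Sum>k = ?h..?m. card (slice S k)) \<le> 2 * min_degree (with_proj G)"
    using sum_card_slice[OF SB(1), of ?h] small unfolding window by simp
  have gap_end: "slice B ?m = {}" using gap slice_period by simp
  obtain r v where rv: "?h \<le> r" "Suc (Suc r) \<le> ?m" "v \<in> layer (Suc r)"
    "slice S r = nbrs v" "slice S (Suc (Suc r)) = nbrs v"
    "card (nbrs v) = min_degree (with_proj G)"
    "\<And>k. ?h \<le> k \<Longrightarrow> k \<le> ?m \<Longrightarrow> k \<noteq> r \<Longrightarrow> k \<noteq> Suc (Suc r) \<Longrightarrow> slice S k = {}"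
    by (rule separating_slices[of "slice B" "slice S" ?h ?m k0,
          OF B_sub S_sub _ _ gap(2) gap_end k0(1,2) inner sum large],
        erule (1) up, erule (1) down, rule that)
  have "S = nbrs v \<times> {r mod n, Suc (Suc r) mod n}"
  proof (intro equalityI subrelI)
    fix u i assume u: "(u, i) \<in> S"
    then have "i < n" using SB by (auto simp: half_def)
    then obtain k where k: "?h \<le> k" "k \<le> ?m" "k mod n = i" using index by blast
    then have "u \<in> slice S k" using u by (simp add: slice_def)
    moreover from this have "k = r \<or> k = Suc (Suc r)" using rv(7)[OF k(1,2)] by blast
    ultimately show "(u, i) \<in> nbrs v \<times> {r mod n, Suc (Suc r) mod n}"
      using rv(4,5) k(3) by auto
  next
    fix u i assume "(u, i) \<in> nbrs v \<times> {r mod n, Suc (Suc r) mod n}"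
    then show "(u, i) \<in> S" using rv(4,5) by (auto simp: slice_def)
  qed
  then have "S = neighborhood component (v, Suc r mod n)"
    using neighborhood_component rv(3) by simp
  moreover have v: "(v, Suc r mod n) \<in> half" using mem_half_mod rv(3) by blast
  moreover have "out_degree component (v, Suc r mod n) = min_degree component"
    using v rv(6) by (simp add: out_degree_component min_degree_component)
  ultimately show ?thesis by auto
qed

text \<open>What \<open>S\<close> leaves of the copy of \<open>G\<close> on layers \<open>g\<close>
  and \<open>Suc g\<close> cannot be split by \<open>B\<close>. The empty alternative in
  \<open>conn\<close> is needed because \<open>vertex_cut\<close> does not count the deletion of all
  vertices.\<close>

lemma slice_one_sided:
  assumes S: "S \<subseteq> half"
    and closed: "closed_under_arcs (component \<restriction> (half - S)) B"
    and conn: "connected (with_proj G \<restriction> (pverts G - (slice S g \<union> slice S (Suc g))))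
      \<or> pverts G - (slice S g \<union> slice S (Suc g)) = {}"
  shows "slice B g = {} \<and> slice B (Suc g) = {} \<or>
    slice (half - S - B) g = {} \<and> slice (half - S - B) (Suc g) = {}"
proof -
  let ?T = "slice S g \<union> slice S (Suc g)"
  let ?K = "with_proj G \<restriction> (pverts G - ?T)"
  let ?D = "slice B g \<union> slice B (Suc g)"
  interpret K: wf_digraph ?K by (rule wellformed_induce_subgraph)
  have "B \<subseteq> half - S" using closed by (simp add: closed_under_arcs_def)
  then have sub: "slice B k \<subseteq> layer k - slice S k" for k
    using slice_subset_layer[of B k] by (auto simp: slice_def)
  have co: "slice (half - S - B) k \<subseteq> layer k - slice S k - slice B k" for k
    using slice_subset_layer[of "half - S - B" k] by (auto simp: slice_def)
  note facts = sub[of g] sub[of "Suc g"] slice_subset_layer[OF S, of g]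
    slice_subset_layer[OF S, of "Suc g"] layer_Un[of g] layer_disjoint[of g]
  have D: "?D \<subseteq> pverts G - ?T"
    using facts by blast
  \<comment> \<open>Arcs starting in layer \<open>g\<close> are treated first; those starting in
    \<open>Suc g\<close> follow by reversal.\<close>
  have across: "x \<in> ?D \<longleftrightarrow> y \<in> ?D"
    if xy: "(x, y) \<in> parcs G" "x \<notin> ?T" "y \<notin> ?T" "x \<in> layer g" for x y
  proof -
    have "y \<in> layer (Suc g)" using xy layer_arc by blast
    moreover have "x \<in> slice B g \<longleftrightarrow> y \<in> slice B (Suc g)"
      using closed_slice_Diff_iff[OF closed xy(1,4)] xy by blast
    ultimately show ?thesis using xy facts by blast
  qed
  have all: "x \<in> ?D \<longleftrightarrow> y \<in> ?D" if xy: "(x, y) \<in> parcs G" "x \<notin> ?T" "y \<notin> ?T" for x y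
  proof (cases "x \<in> layer g")
    case False
    then have "x \<in> layer (Suc g)" using in_arcsD1[OF xy(1)] layer_Un[of g] by blast
    then have "y \<in> layer g" using layer_arc[OF arcs_symmetric[OF xy(1)]] by blast
    then show ?thesis using across[OF arcs_symmetric[OF xy(1)]] xy by blast
  qed (use across xy in blast)
  have "closed_under_arcs ?K ?D"
  proof (rule closed_under_arcsI)
    show "?D \<subseteq> verts ?K" using D by simp
    show "x \<in> ?D \<longleftrightarrow> y \<in> ?D" if "x \<rightarrow>\<^bsub>?K\<^esub> y" for x y
      using that all[of x y] unfolding dominates_induce_iff by simp
  qed
  then have "?D = {} \<or> ?D = pverts G - ?T"
    using conn D K.connected_iff_closed by auto
  then show ?thesis
  proof
    assume "?D = pverts G - ?T"
    then have "slice (half - S - B) g = {}" "slice (half - S - B) (Suc g) = {}"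
      using facts co[of g] co[of "Suc g"] by blast+
    then show ?thesis by simp
  qed simp
qed

text \<open>Here \<open>kappa\<close> is the connectivity bound with denominators cleared, and
  \<open>large\<close> bounds both parts because the layers alternate between them.\<close>

lemma super_connected_component:
  assumes large: "\<And>k. min_degree (with_proj G) < card (layer k)"
    and kappa: "4 * min_degree (with_proj G) < n * vertex_connectivity (with_proj G)"
  shows "super_connected component"
  unfolding super_connected_def
proof (intro allI impI)
  interpret C: graph component by (rule graph_component)
  \<comment> \<open>No vertex is isolated, so \<delta> is positive and every layer has at least two
    vertices. Two vertices of one layer are never adjacent, which rules out completeness
    below.\<close>
  have other: "\<exists>w \<in> layer k. w \<noteq> v" for v k
  proof -
    obtain u where "u \<in> pverts G" "card (nbrs u) = min_degree (with_proj G)"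
      using min_degree_attained by blast
    then have "0 < min_degree (with_proj G)"
      using nbrs_nonempty[of u] finite_nbrs[of u] by (metis card_gt_0_iff)
    then have "\<not> card (layer k) \<le> card {v}" using large[of k] by simp
    then have "\<not> layer k \<subseteq> {v}" using card_mono[of "{v}" "layer k"] by blast
    then show ?thesis by blast
  qed
  fix S assume "min_vertex_cut component S"
  then have cut: "vertex_cut component S" and card_S: "card S = vertex_connectivity component"
    by (auto simp: min_vertex_cut_def)
  have not_complete_G: "\<not> complete_digraph (card (pverts G)) (with_proj G)"
  proof -
    obtain v w where vw: "v \<in> layer 0" "w \<in> layer 0" "w \<noteq> v" using other by metis
    then have "w \<notin> nbrs v" using layer_arc[of v w 0] layer_disjoint[of 0] by (auto simp: nbrs_iff)
    moreover have "graph (with_proj G)" by unfold_locales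
    ultimately show ?thesis
      using vw layer_Un[of 0] by (intro not_complete_digraph[of _ v w]) auto
  qed
  \<comment> \<open>The neighborhood of a copy of a vertex of degree \<delta> separates that copy
    from another vertex of its layer.\<close>
  have "vertex_connectivity component \<le> 2 * min_degree (with_proj G)"
  proof -
    obtain v where v: "v \<in> pverts G" "card (nbrs v) = min_degree (with_proj G)"
      using min_degree_attained by blast
    obtain i where i: "(v, i) \<in> half" using v half_over by blast
    obtain w where w: "w \<in> layer i" "w \<noteq> v" using other by blast
    have vi: "v \<in> layer i" "(w, i) \<in> half" using i w by (auto simp: half_def)
    have "w \<notin> nbrs v" using vi w layer_arc[of v w i] layer_disjoint[of i] by (auto simp: nbrs_iff)
    then have nb: "(w, i) \<notin> neighborhood component (v, i)"
      by (auto simp: neighborhood_def dominates_induce_iff direct_product_def)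
    have "\<not> complete_digraph (card (verts component)) component"
      using i w vi nb by (intro not_complete_digraph[OF graph_component, of "(v, i)" "(w, i)"]) auto
    moreover have "vertex_cut component (neighborhood component (v, i))"
      using i w vi nb by (intro C.vertex_cut_neighborhood[of _ "(w, i)"]) auto
    ultimately show ?thesis
      using C.vertex_connectivity_le card_neighborhood_component[OF i] v by metis
  qed
  then have small: "card S \<le> 2 * min_degree (with_proj G)" using card_S by simp
  have S: "S \<subseteq> half" using cut by (simp add: vertex_cut_def)
  have "2 * card S < n * vertex_connectivity (with_proj G)"
    using small kappa by linarith
  then obtain g where g: "card (slice S g) + card (slice S (Suc g)) < vertex_connectivity (with_proj G)"
    using exists_sparse_gap[OF S] by blast
  let ?T = "slice S g \<union> slice S (Suc g)"
  have T_sub: "?T \<subseteq> pverts G"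
    using slice_subset_layer[OF S] layer_Un[of g] by blast
  \<comment> \<open>The trace of \<open>S\<close> on this copy of \<open>G\<close> is too small to
    be a cut of \<open>G\<close>.\<close>
  have "card ?T < vertex_connectivity (with_proj G)"
    using g card_Un_le[of "slice S g" "slice S (Suc g)"] by linarith
  then have "\<not> vertex_cut (with_proj G) ?T"
    using vertex_connectivity_le[of ?T] not_complete_G by auto
  then have conn: "connected (with_proj G \<restriction> (pverts G - ?T)) \<or> pverts G - ?T = {}"
    using T_sub unfolding vertex_cut_def with_proj_simps by blast
  have "\<not> connected (component \<restriction> (half - S))" "half - S \<noteq> {}"
    using cut by (auto simp: vertex_cut_def)
  then obtain B where B: "closed_under_arcs (component \<restriction> (half - S)) B" "B \<noteq> {}" "B \<noteq> half - S"
    using wf_digraph.connected_iff_closed[OF C.wellformed_induce_subgraph, of "half - S"] by auto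
  let ?B' = "half - S - B"
  have B_sub: "B \<subseteq> half - S" using B by (simp add: closed_under_arcs_def)
  have B': "closed_under_arcs (component \<restriction> (half - S)) ?B'"
    using wf_digraph.closed_under_arcs_Diff[OF C.wellformed_induce_subgraph B(1)] by simp
  have "?B' \<noteq> {}" using B(3) B_sub by blast
  \<comment> \<open>Both \<open>B\<close> and its complement are nonempty and closed, so whichever
    misses the copy can play the role of the side.\<close>
  show "\<exists>v \<in> verts component. out_degree component v = min_degree component \<and> S = neighborhood component v"
    using slice_one_sided[OF S B(1) conn]
  proof
    assume "slice B g = {} \<and> slice B (Suc g) = {}"
    then show ?thesis
      using min_cut_is_neighborhood[OF S B_sub B(2,1) _ _ small large] by blast
  next
    assume "slice ?B' g = {} \<and> slice ?B' (Suc g) = {}"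
    then show ?thesis
      using min_cut_is_neighborhood[OF S Diff_subset \<open>?B' \<noteq> {}\<close> B' _ _ small large] by blast
  qed
qed

subsection \<open>The two components\<close>

lemma swap: "bipartite_cycle_product G Y X n"
  using connected_G bipartition_G n_ge_3 even_n
  by unfold_locales (auto simp: bipartition_def)

text \<open>Rotating the cycle by one step preserves adjacency in the product and flips the parity
  of the index, so it carries one half to the other.\<close>

lemma digraph_iso_swap_component:
  "digraph_iso component (bipartite_cycle_product.component G Y X n)"
proof -
  interpret W: bipartite_cycle_product G Y X n by (rule swap)
  interpret P: pair_graph "direct_product G (cycle_graph n)" by (rule graph_product)
  let ?f = "\<lambda>(u, i). (u :: 'a, Suc i mod n)"
  have W_layer: "W.layer (Suc k) = layer k" for k
    by (simp add: W.layer_def layer_def)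
  have W_half: "(u, Suc k mod n) \<in> W.half \<longleftrightarrow> u \<in> layer k" for u k
    using W.mem_half_mod W_layer by simp
  show ?thesis
  proof (rule digraph_iso_induced)
    show "wf_digraph (with_proj (direct_product G (cycle_graph n)))"
      by unfold_locales
    have "?f ` half = W.half"
    proof (intro equalityI subsetI)
      fix w assume "w \<in> ?f ` half"
      then show "w \<in> W.half" using W_half by (auto simp: half_def)
    next
      fix w assume w: "w \<in> W.half"
      obtain u j where uj: "w = (u, j)" by fastforce
      \<comment> \<open>The inverse rotation, with \<open>n\<close> added to cover
        \<open>j = 0\<close>.\<close>
      let ?i = "(j + n - 1) mod n"
      have j: "j = Suc ?i mod n"
        using w uj n_pos by (simp add: W.half_def mod_Suc_eq)
      then have "u \<in> layer ?i" using w uj W_half by metis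
      then have "(u, ?i) \<in> half" using n_pos by (simp add: half_def)
      then show "w \<in> ?f ` half" using uj j by (intro image_eqI[of _ _ "(u, ?i)"]) auto
    qed
    moreover have "inj_on ?f half"
      using mod_Suc_cancel by (auto simp: inj_on_def half_def)
    ultimately show "bij_betw ?f half W.half" by (simp add: bij_betw_def)
    fix w z assume "w \<in> half" "z \<in> half"
    then obtain u i v j where "w = (u, i)" "z = (v, j)" "i < n" "j < n"
      by (auto simp: half_def)
    then show "(w, z) \<in> parcs (direct_product G (cycle_graph n)) \<longleftrightarrow>
        (?f w, ?f z) \<in> parcs (direct_product G (cycle_graph n))"
      using mod_Suc_cancel[of j "Suc i mod n"] mod_Suc_cancel[of i "Suc j mod n"]
      by (auto simp: direct_product_def cycle_graph_def)
  qed
qed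

lemma connected_components_product:
  "connected_components (with_proj (direct_product G (cycle_graph n))) =
     {component, bipartite_cycle_product.component G Y X n}"
    and component_neq: "component \<noteq> bipartite_cycle_product.component G Y X n"
proof -
  interpret W: bipartite_cycle_product G Y X n by (rule swap)
  interpret P: pair_graph "direct_product G (cycle_graph n)" by (rule graph_product)
  have W_layer: "W.layer k = layer (Suc k)" for k
    by (simp add: W.layer_def layer_def)
  have disj: "half \<inter> W.half = {}"
    using layer_disjoint by (auto simp: half_def W.half_def W_layer)
  have nonempty: "half \<noteq> {}" using connected_component
    by (auto simp: connected_def strongly_connected_def)
  show "component \<noteq> W.component"
    using disj nonempty by (metis Int_absorb induce_subgraph_verts)
  have verts: "pverts (direct_product G (cycle_graph n)) = half \<union> W.half"
    using layer_Un by (force simp: half_def W.half_def W_layer direct_product_def cycle_graph_def)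
  \<comment> \<open>Together with the symmetry of arcs, this excludes arcs between the halves in
    either direction.\<close>
  have arc: "z \<in> half" if wz: "(w, z) \<in> parcs (direct_product G (cycle_graph n))" and w: "w \<in> half" for w z
  proof -
    obtain u i v j where wz': "w = (u, i)" "z = (v, j)" by fastforce
    then have "(u, v) \<in> parcs G" "i < n" "j < n" "j = Suc i mod n \<or> i = Suc j mod n" "u \<in> layer i"
      using that by (auto simp: direct_product_def cycle_graph_def half_def)
    then show ?thesis
      using component_arc_iff[of u i v j] wz' by (auto simp: dominates_induce_iff)
  qed
  show "connected_components (with_proj (direct_product G (cycle_graph n))) = {component, W.component}"
  proof (rule P.connected_components_of_partition)
    show "pverts (direct_product G (cycle_graph n)) = half \<union> W.half"
      by (rule verts)
    show "parcs (direct_product G (cycle_graph n)) \<subseteq> half \<times> half \<union> W.half \<times> W.half"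
    proof (rule subrelI)
      fix w z assume wz: "(w, z) \<in> parcs (direct_product G (cycle_graph n))"
      show "(w, z) \<in> half \<times> half \<union> W.half \<times> W.half"
        using arc[OF wz] arc[OF P.arcs_symmetric[OF wz]] P.in_arcsD1[OF wz] P.in_arcsD2[OF wz]
        unfolding verts by blast
    qed
  qed (use disj connected_component W.connected_component in auto)
qed

end

theorem theorem3p6:
  fixes G :: "'a pair_pre_digraph" and X Y :: "'a set" and n :: nat
  assumes "pair_graph G" and "connected (with_proj G)"
    and "bipartition (with_proj G) X Y"
    and "n \<ge> 6" and "even n"
  shows "card (connected_components (with_proj (direct_product G (cycle_graph n)))) = 2 \<and>
    (\<forall>A \<in> connected_components (with_proj (direct_product G (cycle_graph n))).
     \<forall>B \<in> connected_components (with_proj (direct_product G (cycle_graph n))). digraph_iso A B) \<and>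
    (card X \<ge> min_degree (with_proj G) + 1 \<and> card Y \<ge> min_degree (with_proj G) + 1 \<and>
      real (vertex_connectivity (with_proj G)) > 4 / real n * real (min_degree (with_proj G)) \<longrightarrow>
     (\<forall>A \<in> connected_components (with_proj (direct_product G (cycle_graph n))).
        super_connected A))"
proof -
  interpret G: pair_graph G by fact
  interpret L: bipartite_cycle_product G X Y n
    using assms by unfold_locales auto
  interpret R: bipartite_cycle_product G Y X n
    by (rule L.swap)
  note components = L.connected_components_product
  have iso: "digraph_iso L.component R.component" "digraph_iso R.component L.component"
    by (rule L.digraph_iso_swap_component R.digraph_iso_swap_component)+
  have "card (connected_components (with_proj (direct_product G (cycle_graph n)))) = 2"
    using components L.component_neq by simp
  \<comment> \<open>The cases \<open>A = B\<close> come from composing the two isomorphisms between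
    the halves.\<close>
  moreover have "digraph_iso A B"
    if "A \<in> {L.component, R.component}" "B \<in> {L.component, R.component}" for A B
    using that iso digraph_iso_trans[OF iso] digraph_iso_trans[OF iso(2,1)] by blast
  moreover have "super_connected L.component" "super_connected R.component"
    if *: "card X \<ge> min_degree (with_proj G) + 1" "card Y \<ge> min_degree (with_proj G) + 1"
      "real (vertex_connectivity (with_proj G)) > 4 / real n * real (min_degree (with_proj G))"
  proof -
    \<comment> \<open>Multiplying by the positive \<open>n\<close> clears the fraction, so that the
      bound can be read in the naturals.\<close>
    have "real (4 * min_degree (with_proj G)) < real (n * vertex_connectivity (with_proj G))"
      using *(3) \<open>n \<ge> 6\<close> by (simp add: field_simps)
    then have kappa: "4 * min_degree (with_proj G) < n * vertex_connectivity (with_proj G)"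
      by (simp only: of_nat_less_iff)
    show "super_connected L.component"
      using *(1,2) kappa by (intro L.super_connected_component) (auto simp: L.layer_def)
    show "super_connected R.component"
      using *(1,2) kappa by (intro R.super_connected_component) (auto simp: R.layer_def)
  qed
  ultimately show ?thesis
    unfolding components by blast
qed

end
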